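(* Let $d\ge 2$ be an integer and $X=\{0,1,\ldots,d-1\}$. Let $f(x)=a_0+a_1x+\cdots+a_tx^t\in\mathbb{Z}[x]$, regarded as inducing an endomorphism of the rooted $d$-ary tree $X^*$. Then for every $x_0\in X$, the image of the vertex $x_0$ (of the first level) under the induced endomorphism is $R_d(f(x_0))$, and the section of $f$ at $x_0$ is again (the endomorphism induced by) a polynomial in $\mathbb{Z}[x]$, given by $$f|_{x_0}(x)=Q_d(f(x_0))+\sum_{i=1}^{t}\frac{f^{(i)}(x_0)}{i!}\,d^{\,i-1}x^i,$$ where $f^{(i)}$ denotes the $i$-th derivative of $f$.
   Context: Tree: $X^*$ is the set of all finite words over $X=\{0,1,\ldots,d-1\}$, viewed as a rooted $d$-ary tree in which each word $v$ is adjacent to $vx$ for $x\in X$; the root is the empty word and the $n$-th level is $X^n$. The level $X^n$ is identified with $\mathbb{Z}/d^n\mathbb{Z}$ via $x_0x_1\ldots x_{n-1}\mapsto x_0+dx_1+\cdots+d^{n-1}x_{n-1}$. Induced map: a polynomial $f\in\mathbb{Z}[x]$ induces evaluation maps $f_n:\mathbb{Z}/d^n\mathbb{Z}\to\mathbb{Z}/d^n\mathbb{Z}$ for all $n\ge 1$, and hence, via the identification above (and fixing the root), a map $X^*\to X^*$ sending each level to itself. This map preserves adjacency, i.e. it is an endomorphism of $X^*$; it is denoted by the same letter $f$. Sections: if $h$ is a level-preserving endomorphism of $X^*$ and $x\in X$, then for each $v\in X^*$ one has $h(xv)=h(x)v'$ for a unique $v'\in X^*$; the section of $h$ at $x$ is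 the endomorphism $h|_x:X^*\to X^*$, $h|_x(v)=v'$. Notation: for integers $d>0$ and $a$, write $a=dq+r$ with $q\in\mathbb{Z}$ and $r\in\{0,1,\ldots,d-1\}$; then $Q_d(a)=q$ and $R_d(a)=r$. *)

theory Defs
  imports Complex_Main "HOL-Computational_Algebra.Polynomial"
begin

text \<open>Vertices of the rooted tree are finite words over the alphabet; letters are integers, so that
  a letter can also be used as an argument of an integer polynomial.\<close>

definition alphabet :: "int \<Rightarrow> int set" where
  "alphabet d = {0..<d}"

definition tree_words :: "int \<Rightarrow> int list set" where
  "tree_words d = lists (alphabet d)"

definition tree_level :: "int \<Rightarrow> nat \<Rightarrow> int list set" where
  "tree_level d n = {w \<in> tree_words d. length w = n}"

definition tree_adj :: "int \<Rightarrow> int list \<Rightarrow> int list \<Rightarrow> bool" where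
  "tree_adj d u w \<longleftrightarrow> u \<in> tree_words d \<and> w \<in> tree_words d \<and>
     (\<exists>x. w = u @ [x] \<or> u = w @ [x])"

text \<open>Level-preserving endomorphisms; only the values on \<^term>\<open>tree_words d\<close> matter.
  Preservation of the root is the case of level 0.\<close>

definition tree_endo :: "int \<Rightarrow> (int list \<Rightarrow> int list) \<Rightarrow> bool" where
  "tree_endo d h \<longleftrightarrow>
     (\<forall>n. \<forall>w \<in> tree_level d n. h w \<in> tree_level d n) \<and>
     (\<forall>u w. tree_adj d u w \<longrightarrow> tree_adj d (h u) (h w))"

text \<open>The identification of level \<open>n\<close> with the integers modulo \<open>d ^ n\<close>, the latter being represented
  by their least nonnegative representatives; see \<open>bij_betw_word_val\<close> below.\<close>

definition word_val :: "int \<Rightarrow> int list \<Rightarrow> int" where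
  "word_val d w = (\<Sum>i<length w. w ! i * d ^ i)"

definition val_word :: "int \<Rightarrow> nat \<Rightarrow> int \<Rightarrow> int list" where
  "val_word d n = inv_into (tree_level d n) (word_val d)"

definition residue_eval :: "int poly \<Rightarrow> int \<Rightarrow> int \<Rightarrow> int" where
  "residue_eval f m a = poly f a mod m"

definition induced_map :: "int \<Rightarrow> int poly \<Rightarrow> int list \<Rightarrow> int list" where
  "induced_map d f w =
     val_word d (length w) (residue_eval f (d ^ length w) (word_val d w))"

text \<open>For an endomorphism \<open>h\<close> the description is unique on words; see \<open>tree_section_unique\<close> below.\<close>

definition tree_section :: "int \<Rightarrow> (int list \<Rightarrow> int list) \<Rightarrow> int \<Rightarrow> int list \<Rightarrow> int list" where
  "tree_section d h x v = (THE v'. v' \<in> tree_words d \<and> h (x # v) = h [x] @ v')"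

definition quot :: "int \<Rightarrow> int \<Rightarrow> int" where
  "quot d a = a div d"

definition remd :: "int \<Rightarrow> int \<Rightarrow> int" where
  "remd d a = a mod d"

lemma quot_remd:
  assumes "d > 0"
  shows "a = d * quot d a + remd d a" "remd d a \<in> alphabet d"
  using assms by (simp_all add: quot_def remd_def alphabet_def)


subsection \<open>Well-definedness of the notions above\<close>

lemma word_val_Nil [simp]: "word_val d [] = 0"
  by (simp add: word_val_def)

lemma word_val_Cons [simp]: "word_val d (x # w) = x + d * word_val d w"
  unfolding word_val_def
  by (simp add: sum.lessThan_Suc_shift sum_distrib_left mult.assoc mult.left_commute
      del: sum.lessThan_Suc)

lemma word_val_snoc: "word_val d (w @ [x]) = word_val d w + x * d ^ length w"
  by (induction w) (simp_all add: algebra_simps)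

lemma tree_level_0: "tree_level d 0 = {[]}"
  by (auto simp: tree_level_def tree_words_def)

lemma Cons_in_tree_level:
  "x # w \<in> tree_level d (Suc n) \<longleftrightarrow> x \<in> alphabet d \<and> w \<in> tree_level d n"
  by (auto simp: tree_level_def tree_words_def)

lemma snoc_in_tree_level:
  "w @ [x] \<in> tree_level d (Suc n) \<longleftrightarrow> x \<in> alphabet d \<and> w \<in> tree_level d n"
  by (auto simp: tree_level_def tree_words_def)

lemma bij_betw_word_val:
  assumes "d > 0"
  shows "bij_betw (word_val d) (tree_level d n) {0..<d ^ n}"
proof (induction n)
  case 0
  then show ?case by (auto simp: tree_level_0 bij_betw_def)
next
  case (Suc n)
  have inj: "inj_on (word_val d) (tree_level d (Suc n))"
  proof (rule inj_onI)
    fix u w assume u: "u \<in> tree_level d (Suc n)" and w: "w \<in> tree_level d (Suc n)"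
      and eq: "word_val d u = word_val d w"
    obtain x u' where u': "u = x # u'"
      using u by (cases u) (auto simp: tree_level_def)
    obtain y w' where w': "w = y # w'"
      using w by (cases w) (auto simp: tree_level_def)
    have x: "x \<in> alphabet d" "u' \<in> tree_level d n" and y: "y \<in> alphabet d" "w' \<in> tree_level d n"
      using u w by (simp_all add: u' w' Cons_in_tree_level)
    have e: "x + d * word_val d u' = y + d * word_val d w'"
      using eq by (simp add: u' w')
    have "(x + d * word_val d u') mod d = (y + d * word_val d w') mod d"
      by (simp only: e)
    then have "x = y"
      using x y by (simp add: alphabet_def)
    with e have "word_val d u' = word_val d w'"
      using assms by simp
    then have "u' = w'"
      using Suc.IH x y by (auto simp: bij_betw_def dest: inj_onD)
    with \<open>x = y\<close> show "u = w" by (simp add: u' w')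
  qed
  have into: "word_val d w \<in> {0..<d ^ Suc n}" if wl: "w \<in> tree_level d (Suc n)" for w
  proof -
    obtain x w' where w': "w = x # w'"
      using wl by (cases w) (auto simp: tree_level_def)
    have x: "0 \<le> x" "x < d" "w' \<in> tree_level d n"
      using wl by (simp_all add: w' Cons_in_tree_level alphabet_def)
    have "word_val d w' \<in> {0..<d ^ n}"
      using bij_betwE[OF Suc.IH] x by blast
    then have v: "0 \<le> word_val d w'" "word_val d w' + 1 \<le> d ^ n"
      by simp_all
    have "d * (word_val d w' + 1) \<le> d * d ^ n"
      using v assms by (intro mult_left_mono) auto
    then show ?thesis
      using x v assms by (simp add: w' algebra_simps)
  qed
  have onto: "a \<in> word_val d ` tree_level d (Suc n)" if "a \<in> {0..<d ^ Suc n}" for a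
  proof -
    have "d * (a div d) \<le> a"
      using assms pos_mod_sign[of d a] mult_div_mod_eq[of d a] by linarith
    also have "\<dots> < d * d ^ n"
      using that by simp
    finally have "a div d < d ^ n"
      using assms by simp
    then have "a div d \<in> {0..<d ^ n}"
      using that assms by (simp add: pos_imp_zdiv_nonneg_iff)
    then have "a div d \<in> word_val d ` tree_level d n"
      using bij_betw_imp_surj_on[OF Suc.IH] by simp
    then obtain w where w: "w \<in> tree_level d n" "word_val d w = a div d"
      by force
    then have "(a mod d) # w \<in> tree_level d (Suc n)"
      using assms by (simp add: Cons_in_tree_level alphabet_def)
    moreover have "word_val d ((a mod d) # w) = a"
      by (simp add: w)
    ultimately show ?thesis by force
  qed
  show ?case
    unfolding bij_betw_def using inj into onto by blast
qed

lemma residue_eval_mod: "residue_eval f m (a mod m) = residue_eval f m a"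
  unfolding residue_eval_def
proof (induction f)
  case (pCons c f)
  have "(a mod m) * poly f (a mod m) mod m = a * poly f a mod m"
    by (metis mod_mult_eq mod_mod_trivial pCons.IH)
  then show ?case
    by simp (metis mod_add_right_eq)
qed simp

lemma
  assumes "d > 0" and "w \<in> tree_level d n"
  shows induced_map_level: "induced_map d f w \<in> tree_level d n"
    and word_val_induced_map: "word_val d (induced_map d f w) = residue_eval f (d ^ n) (word_val d w)"
proof -
  have n: "length w = n" using assms by (simp add: tree_level_def)
  have "residue_eval f (d ^ n) (word_val d w) \<in> word_val d ` tree_level d n"
    using bij_betw_word_val[OF assms(1), of n] assms(1) by (simp add: bij_betw_def residue_eval_def)
  then show "induced_map d f w \<in> tree_level d n"
    "word_val d (induced_map d f w) = residue_eval f (d ^ n) (word_val d w)"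
    unfolding induced_map_def val_word_def n by (rule inv_into_into, rule f_inv_into_f)
qed

lemma induced_map_snoc:
  assumes "d > 0" and "u @ [x] \<in> tree_words d"
  shows "\<exists>y. induced_map d f (u @ [x]) = induced_map d f u @ [y]"
proof -
  define n where "n = length u"
  have ux: "u @ [x] \<in> tree_level d (Suc n)" and u: "u \<in> tree_level d n"
    using assms by (auto simp: n_def tree_level_def tree_words_def)
  have lv: "induced_map d f (u @ [x]) \<in> tree_level d (Suc n)"
    by (rule induced_map_level[OF assms(1) ux])
  then obtain p y where p: "induced_map d f (u @ [x]) = p @ [y]"
    by (cases "induced_map d f (u @ [x])" rule: rev_cases) (auto simp: tree_level_def)
  have pl: "p \<in> tree_level d n"
    using lv by (simp add: p snoc_in_tree_level)
  then have lp: "length p = n" by (simp add: tree_level_def)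
  have pv: "word_val d p \<in> {0..<d ^ n}"
    using bij_betwE[OF bij_betw_word_val[OF assms(1)]] pl by blast
  have "word_val d p + y * d ^ n = residue_eval f (d ^ Suc n) (word_val d u + x * d ^ n)"
    using word_val_induced_map[OF assms(1) ux, of f] by (simp add: p word_val_snoc lp n_def)
  then have "(word_val d p + y * d ^ n) mod d ^ n =
      residue_eval f (d ^ Suc n) (word_val d u + x * d ^ n) mod d ^ n"
    by simp
  also have "\<dots> = residue_eval f (d ^ n) (word_val d u + x * d ^ n)"
    unfolding residue_eval_def by (rule mod_mod_cancel) simp
  also have "\<dots> = residue_eval f (d ^ n) (word_val d u)"
    by (subst (1 2) residue_eval_mod[symmetric]) simp
  also have "\<dots> = word_val d (induced_map d f u)"
    using word_val_induced_map[OF assms(1) u] by simp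
  finally have "word_val d p = word_val d (induced_map d f u)"
    using pv by simp
  then have "p = induced_map d f u"
    using bij_betw_word_val[OF assms(1), of n] pl induced_map_level[OF assms(1) u]
    by (auto simp: bij_betw_def dest: inj_onD)
  with p show ?thesis by blast
qed

lemma tree_endo_induced_map:
  assumes "d > 0"
  shows "tree_endo d (induced_map d f)"
proof -
  have "induced_map d f w \<in> tree_words d" if "w \<in> tree_words d" for w
    using induced_map_level[OF assms, of w "length w"] that by (simp add: tree_level_def)
  then show ?thesis
    using induced_map_level[OF assms] induced_map_snoc[OF assms]
    unfolding tree_endo_def tree_adj_def by metis
qed

lemma tree_section_unique:
  assumes h: "tree_endo d h" and x: "x \<in> alphabet d" and v: "v \<in> tree_words d"
  shows "\<exists>!v'. v' \<in> tree_words d \<and> h (x # v) = h [x] @ v'"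
proof -
  have len: "length (h w) = length w" and wd: "h w \<in> tree_words d" if "w \<in> tree_words d" for w
    using h that by (auto simp: tree_endo_def tree_level_def)
  have "\<exists>v'. v' \<in> tree_words d \<and> h (x # v) = h [x] @ v'"
    using v
  proof (induction v rule: rev_induct)
    case Nil
    then show ?case by (auto simp: tree_words_def)
  next
    case (snoc y v)
    have w: "v \<in> tree_words d" "x # v \<in> tree_words d" "x # v @ [y] \<in> tree_words d"
      using snoc.prems x by (auto simp: tree_words_def)
    then obtain v' where v': "v' \<in> tree_words d" "h (x # v) = h [x] @ v'"
      using snoc.IH by blast
    have "tree_adj d (x # v) (x # v @ [y])"
      using w by (simp add: tree_adj_def)
    then have "tree_adj d (h (x # v)) (h (x # v @ [y]))"
      using h by (simp add: tree_endo_def)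
    then obtain z where z: "h (x # v @ [y]) = h (x # v) @ [z] \<or> h (x # v) = h (x # v @ [y]) @ [z]"
      by (auto simp: tree_adj_def)
    have "length (h (x # v @ [y])) = Suc (length (h (x # v)))"
      using len w by simp
    with z have "h (x # v @ [y]) = h (x # v) @ [z]" by auto
    then have e: "h (x # v @ [y]) = h [x] @ (v' @ [z])"
      by (simp add: v')
    moreover have "v' @ [z] \<in> tree_words d"
      using wd[OF w(3)] unfolding e by (simp add: tree_words_def)
    ultimately show ?case by blast
  qed
  then show ?thesis by auto
qed

end

theory Submission
  imports Defs
begin

text \<open>By Taylor's formula at \<open>x\<^sub>0\<close>, \<open>f (x\<^sub>0 + d y) = f(x\<^sub>0) + d (\<Sum>i\<ge>1. c\<^sub>i d ^ (i - 1) y ^ i)\<close>, where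
  \<open>c\<^sub>i = f\<^sup>(\<^sup>i\<^sup>)(x\<^sub>0) / i!\<close> are the integer coefficients of \<open>f (x\<^sub>0 + y)\<close>. Dividing \<open>f(x\<^sub>0)\<close> by \<open>d\<close>
  with remainder \<open>r\<close> gives \<open>f (x\<^sub>0 + d y) = r + d g(y)\<close>, and reducing this modulo \<open>d ^ (n + 1)\<close>
  says that \<open>f\<close> sends a word \<open>x\<^sub>0 v\<close> to \<open>r g(v)\<close>.\<close>

lemma higher_pderiv_pcompose_translate:
  fixes p :: "'a :: idom poly"
  shows "(pderiv ^^ n) (pcompose p [:c, 1:]) = pcompose ((pderiv ^^ n) p) [:c, 1:]"
  by (induction n) (simp_all add: pderiv_pcompose pderiv_pCons)

text \<open>Differentiating \<open>n\<close> times moves coefficient \<open>n\<close> to the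
  constant term with factor \<open>fact n\<close>, and differentiation commutes with translation.
  Over the integers this makes the Taylor coefficients integral.\<close>

lemma fact_mult_coeff_pcompose_translate:
  fixes p :: "'a :: {idom, semiring_char_0} poly"
  shows "fact n * coeff (pcompose p [:c, 1:]) n = poly ((pderiv ^^ n) p) c"
proof -
  have "fact n * coeff (pcompose p [:c, 1:]) n = coeff ((pderiv ^^ n) (pcompose p [:c, 1:])) 0"
    by (simp add: coeff_higher_pderiv pochhammer_fact pochhammer_of_nat)
  also have "\<dots> = poly ((pderiv ^^ n) p) c"
    by (simp add: higher_pderiv_pcompose_translate poly_pcompose flip: poly_0_coeff_0)
  finally show ?thesis .
qed

text \<open>Taylor's formula; a bound \<open>t\<close> instead of the exact degree allows for a
  vanishing top coefficient.\<close>

lemma poly_add_eq_translate_sum: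
  fixes p :: "'a :: {idom, semiring_char_0} poly"
  assumes "degree p \<le> t"
  shows "poly p (c + y) = poly p c + (\<Sum>i=1..t. coeff (pcompose p [:c, 1:]) i * y ^ i)"
proof -
  let ?q = "pcompose p [:c, 1:]"
  have "poly p (c + y) = poly ?q y"
    by (simp add: poly_pcompose)
  also have "\<dots> = (\<Sum>i\<le>t. coeff ?q i * y ^ i)"
    unfolding poly_altdef using assms
    by (intro sum.mono_neutral_left) (auto simp: degree_pcompose coeff_eq_0)
  also have "\<dots> = coeff ?q 0 + (\<Sum>i=1..t. coeff ?q i * y ^ i)"
    by (simp add: sum.atLeast_Suc_atMost flip: atLeast0AtMost)
  also have "coeff ?q 0 = poly p c"
    using fact_mult_coeff_pcompose_translate[of 0 p c] by simp
  finally show ?thesis .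
qed

text \<open>The first letter is the lowest base-\<open>d\<close> digit, so the hypothesis on
  \<open>f\<close> and \<open>g\<close> splits off the digit \<open>r\<close>, and a word is
  determined by its level and value.\<close>

lemma induced_map_Cons:
  assumes d: "d > 0" and x: "x \<in> alphabet d" and v: "v \<in> tree_words d" and r: "r \<in> alphabet d"
    and fg: "\<And>y. poly f (x + d * y) = r + d * poly g y"
  shows "induced_map d f (x # v) = r # induced_map d g v"
proof -
  define n where "n = length v"
  have vl: "v \<in> tree_level d n" and xvl: "x # v \<in> tree_level d (Suc n)"
    using v x by (simp_all add: n_def tree_words_def tree_level_def)
  have "word_val d (induced_map d f (x # v)) = (r + d * poly g (word_val d v)) mod (d * d ^ n)"
    by (simp add: word_val_induced_map[OF d xvl] residue_eval_def fg)
  \<comment> \<open>As 0 \<le> \<open>r\<close> < \<open>d\<close>, division by \<open>d\<close>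
    leaves quotient \<open>poly g (word_val d v)\<close> and remainder \<open>r\<close>.\<close>
  also have "\<dots> = r + d * (poly g (word_val d v) mod d ^ n)"
    using r d by (simp add: alphabet_def mod_mult2_eq' zmod_zmult2_eq)
  also have "\<dots> = word_val d (r # induced_map d g v)"
    by (simp add: word_val_induced_map[OF d vl] residue_eval_def)
  finally show ?thesis
    using induced_map_level[OF d xvl, of f] induced_map_level[OF d vl, of g] r
    by (intro inj_onD[OF bij_betw_imp_inj_on[OF bij_betw_word_val[OF d, of "Suc n"]]])
      (simp_all add: Cons_in_tree_level)
qed

theorem theorem3p2:
  fixes d :: int and t :: nat and a :: "nat \<Rightarrow> int" and f :: "int poly" and x0 :: int
  assumes "d \<ge> 2"
    and "f = (\<Sum>i\<le>t. monom (a i) i)"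
    and "x0 \<in> alphabet d"
  shows "induced_map d f [x0] = [remd d (poly f x0)] \<and>
    (\<exists>g :: int poly.
       map_poly rat_of_int g =
         [:rat_of_int (quot d (poly f x0)):] +
         (\<Sum>i=1..t. monom (rat_of_int (poly ((pderiv ^^ i) f) x0) / fact i
                            * rat_of_int d ^ (i - 1)) i) \<and>
       (\<forall>v \<in> tree_words d. tree_section d (induced_map d f) x0 v = induced_map d g v))"
proof -
  have d: "d > 0" using assms(1) by simp
  have deg: "degree f \<le> t"
    unfolding assms(2) by (intro degree_sum_le) (auto intro: order.trans[OF degree_monom_le])
  define c where "c i = coeff (pcompose f [:x0, 1:]) i" for i
  define r where "r = remd d (poly f x0)"
  define g where "g = [:quot d (poly f x0):] + (\<Sum>i=1..t. monom (c i * d ^ (i - 1)) i)"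
  have r: "r \<in> alphabet d" and f0: "poly f x0 = d * quot d (poly f x0) + r"
    using quot_remd[OF d] by (simp_all add: r_def)
  have fg: "poly f (x0 + d * y) = r + d * poly g y" for y
  proof -
    \<comment> \<open>Since i \<ge> 1, each term gives up one factor \<open>d\<close>.\<close>
    have "(\<Sum>i=1..t. c i * (d * y) ^ i) = d * (\<Sum>i=1..t. c i * d ^ (i - 1) * y ^ i)"
      unfolding sum_distrib_left
      by (intro sum.cong) (auto simp: power_mult_distrib power_eq_if[of d])
    then show ?thesis
      using poly_add_eq_translate_sum[OF deg, of x0 "d * y"] f0
      by (simp add: g_def c_def poly_sum poly_monom distrib_left)
  qed
  have Cons: "induced_map d f (x0 # v) = r # induced_map d g v" if "v \<in> tree_words d" for v
    using induced_map_Cons[OF d assms(3) that r fg] .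
  have "induced_map d g [] = []"
    using induced_map_level[OF d, of "[]" 0 g] by (simp add: tree_level_0)
  then have root: "induced_map d f [x0] = [r]"
    using Cons[of "[]"] by (simp add: tree_words_def)
  have c: "rat_of_int (poly ((pderiv ^^ i) f) x0) / fact i = rat_of_int (c i)" for i
    by (simp add: c_def flip: fact_mult_coeff_pcompose_translate)
  have "map_poly rat_of_int g = [:rat_of_int (quot d (poly f x0)):] +
      (\<Sum>i=1..t. monom (rat_of_int (poly ((pderiv ^^ i) f) x0) / fact i
                         * rat_of_int d ^ (i - 1)) i)"
    unfolding c g_def
    by (intro poly_eqI) (simp add: coeff_map_poly coeff_sum coeff_pCons if_distrib cong: if_cong split: nat.split)
  moreover have "tree_section d (induced_map d f) x0 v = induced_map d g v"
    if v: "v \<in> tree_words d" for v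
  proof -
    have "induced_map d g v \<in> tree_words d"
      using induced_map_level[OF d, of v "length v" g] v by (simp add: tree_level_def)
    \<comment> \<open>\<open>Cons\<close> and \<open>root\<close> exhibit
      \<open>induced_map d g v\<close> as a suffix after the image of \<open>[x0]\<close>;
      uniqueness identifies it with the section.\<close>
    then show ?thesis
      unfolding tree_section_def
      using tree_section_unique[OF tree_endo_induced_map[OF d] assms(3) v, of f]
      by (intro the1_equality) (simp_all add: Cons[OF v] root)
  qed
  ultimately show ?thesis
    using root unfolding r_def by blast
qed

end
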